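(* Let $G$ be a separable compact topological group and let $H$ be a topological group in which all closed subgroups are separable. Then all closed subgroups of the product group $G\times H$ (with the product topology) are separable.
   Context: All topological groups are assumed to be Hausdorff. A space is separable if it contains a countable dense subset; a subgroup is called separable if it is separable in the subspace topology. *)

theory Defs
  imports "HOL-Analysis.Analysis" "HOL-Algebra.Group"
begin

text \<open>
  Topological groups are given by an explicit carrier and an explicit topology on it.
  As usual in this context, the Hausdorff property is part of the notion.
\<close>

locale topological_group = group G for G (structure) +
  fixes T
  assumes topspace_eq: "topspace T = carrier G"
    and continuous_mult: "continuous_map (prod_topology T T) T (\<lambda>(x, y). x \<otimes> y)"
    and continuous_inv: "continuous_map T T (\<lambda>x. inv x)"
    and Hausdorff: "Hausdorff_space T"

lemma topological_group_DirProd: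
  assumes G: "topological_group G S" and H: "topological_group H T"
  shows "topological_group (G \<times>\<times> H) (prod_topology S T)"
proof -
  interpret G: topological_group G S by (rule G)
  interpret H: topological_group H T by (rule H)
  interpret P: group "G \<times>\<times> H"
    by (rule DirProd_group) unfold_locales
  let ?P = "prod_topology S T"
  have fst_fst: "continuous_map (prod_topology ?P ?P) S (\<lambda>x. fst (fst x))"
    and snd_fst: "continuous_map (prod_topology ?P ?P) T (\<lambda>x. snd (fst x))"
    and fst_snd: "continuous_map (prod_topology ?P ?P) S (\<lambda>x. fst (snd x))"
    and snd_snd: "continuous_map (prod_topology ?P ?P) T (\<lambda>x. snd (snd x))"
    by (rule continuous_map_compose[OF continuous_map_fst continuous_map_fst, unfolded o_def]
        continuous_map_compose[OF continuous_map_fst continuous_map_snd, unfolded o_def]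
        continuous_map_compose[OF continuous_map_snd continuous_map_fst, unfolded o_def]
        continuous_map_compose[OF continuous_map_snd continuous_map_snd, unfolded o_def])+
  have m1: "continuous_map (prod_topology ?P ?P) S (\<lambda>x. fst (fst x) \<otimes>\<^bsub>G\<^esub> fst (snd x))"
    using continuous_map_compose[OF continuous_map_pairedI[OF fst_fst fst_snd] G.continuous_mult]
    by (simp add: o_def)
  have m2: "continuous_map (prod_topology ?P ?P) T (\<lambda>x. snd (fst x) \<otimes>\<^bsub>H\<^esub> snd (snd x))"
    using continuous_map_compose[OF continuous_map_pairedI[OF snd_fst snd_snd] H.continuous_mult]
    by (simp add: o_def)
  show ?thesis
  proof
    show "topspace ?P = carrier (G \<times>\<times> H)"
      by (simp add: G.topspace_eq H.topspace_eq)
    show "continuous_map (prod_topology ?P ?P) ?P (\<lambda>(x, y). x \<otimes>\<^bsub>G \<times>\<times> H\<^esub> y)"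
      using continuous_map_pairedI[OF m1 m2]
      by (simp add: case_prod_unfold mult_DirProd')
    have "continuous_map ?P ?P (\<lambda>x. (inv\<^bsub>G\<^esub> fst x, inv\<^bsub>H\<^esub> snd x))"
      using continuous_map_pairedI[OF
          continuous_map_compose[OF continuous_map_fst G.continuous_inv]
          continuous_map_compose[OF continuous_map_snd H.continuous_inv]]
      by (simp add: o_def)
    then show "continuous_map ?P ?P (\<lambda>x. inv\<^bsub>G \<times>\<times> H\<^esub> x)"
      by (rule continuous_map_eq)
         (auto simp: G.topspace_eq H.topspace_eq inv_DirProd G.group_axioms H.group_axioms)
    show "Hausdorff_space ?P"
      by (simp add: Hausdorff_space_prod_topology G.Hausdorff H.Hausdorff)
  qed
qed

end

theory Submission
  imports Defs "HOL-Algebra.Coset"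
begin

text \<open>
  Let \<open>N\<close> be a closed subgroup of a compact group \<open>G\<close>. There is a section \<open>s : G/N \<rightarrow> G\<close> that is
  continuous at the single point \<open>N\<close>, with \<open>s(N) = 1\<close>: by Zorn's lemma take a maximally refined
  section \<open>G/N \<rightarrow> G/P\<close> with this property, \<open>P \<le> N\<close> closed; if \<open>P\<close> were nontrivial, it could be
  refined to a section into \<open>G/(P \<inter> Q)\<close> for a closed subgroup \<open>Q = \<Inter>n. U n\<close>
  with \<open>U (n + 1) (U (n + 1))\<^sup>-\<^sup>1 \<subseteq> U n\<close>. The retraction \<open>g \<mapsto> s(gN)\<^sup>-\<^sup>1 g\<close> from \<open>G\<close> onto \<open>N\<close> is
  continuous at every point of \<open>N\<close>, hence maps dense subsets of \<open>G\<close> to dense subsets of \<open>N\<close>. So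
  closed subgroups of separable compact groups are separable.

  For a closed subgroup \<open>D\<close> of \<open>G \<times> H\<close>, compactness of \<open>G\<close> makes the projection of \<open>D\<close> to \<open>H\<close> an
  open map onto a closed subgroup of \<open>H\<close>. Its image is separable, and so are its fibres, which are
  translates of a closed subgroup of \<open>G\<close>.
\<close>

section \<open>Compactness, and separability along open maps\<close>

text \<open>Were no member of \<open>\<C>\<close> inside \<open>U\<close>, the closed sets
  \<open>C - U\<close> would have the finite intersection property, because finitely many members of
  a chain all contain some one member. Compactness would then yield a point of
  \<open>\<Inter>\<C>\<close> outside \<open>U\<close>.\<close>

lemma compact_space_chain_subset:
  assumes "compact_space X" and closed: "\<And>C. C \<in> \<C> \<Longrightarrow> closedin X C" and "\<C> \<noteq> {}"
    and chain: "\<And>A B. A \<in> \<C> \<Longrightarrow> B \<in> \<C> \<Longrightarrow> A \<subseteq> B \<or> B \<subseteq> A"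
    and "openin X U" "\<Inter>\<C> \<subseteq> U"
  shows "\<exists>C\<in>\<C>. C \<subseteq> U"
proof (rule ccontr)
  assume neg: "\<not> ?thesis"
  have least: "\<exists>A\<in>\<C>. \<forall>B\<in>\<F>. A \<subseteq> B" if "finite \<F>" "\<F> \<subseteq> \<C>" for \<F>
    using that
  proof (induction \<F>)
    case empty
    then show ?case using \<open>\<C> \<noteq> {}\<close> by auto
  next
    case (insert B \<F>)
    then obtain A where A: "A \<in> \<C>" "\<forall>B\<in>\<F>. A \<subseteq> B" by auto
    then consider "A \<subseteq> B" | "B \<subseteq> A" using chain[of A B] insert.prems by blast
    then show ?case
    proof cases
      case 1
      with A show ?thesis by blast
    next
      case 2
      have "\<forall>C\<in>insert B \<F>. B \<subseteq> C" using 2 A by blast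
      then show ?thesis using insert.prems by blast
    qed
  qed
  have "topspace X \<inter> \<Inter>((\<lambda>C. C - U) ` \<C>) \<noteq> {}"
  proof -
    have "closedin X C" if "C \<in> (\<lambda>C. C - U) ` \<C>" for C
      using that closed \<open>openin X U\<close> by (auto intro: closedin_diff)
    moreover have "topspace X \<inter> \<Inter>\<F> \<noteq> {}" if F: "finite \<F>" "\<F> \<subseteq> (\<lambda>C. C - U) ` \<C>" for \<F>
    proof -
      obtain \<G> where \<G>: "finite \<G>" "\<G> \<subseteq> \<C>" "\<F> = (\<lambda>C. C - U) ` \<G>"
        using finite_subset_image[OF F] by blast
      then obtain A where A: "A \<in> \<C>" "\<forall>B\<in>\<G>. A \<subseteq> B" using least by blast
      moreover obtain x where "x \<in> A" "x \<notin> U" using A neg by blast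
      moreover have "x \<in> topspace X" using closed A \<open>x \<in> A\<close> closedin_subset by blast
      ultimately have "x \<in> topspace X \<inter> \<Inter>\<F>" unfolding \<G>(3) by blast
      then show ?thesis by blast
    qed
    ultimately show ?thesis
      using \<open>compact_space X\<close> unfolding compact_space_def compactin_fip
      by (elim conjE allE[of _ "(\<lambda>C. C - U) ` \<C>"]) metis
  qed
  then show False using \<open>\<C> \<noteq> {}\<close> \<open>\<Inter>\<C> \<subseteq> U\<close> by auto
qed

lemma compact_space_decseq_subset:
  assumes "compact_space X" "\<And>n. closedin X (C n)" "decseq C" "openin X U" "(\<Inter>n. C n) \<subseteq> U"
  shows "\<exists>n. C n \<subseteq> U"
proof -
  have "\<exists>D\<in>range C. D \<subseteq> U"
  proof (rule compact_space_chain_subset[OF assms(1)])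
    show "A \<subseteq> B \<or> B \<subseteq> A" if "A \<in> range C" "B \<in> range C" for A B
      using that \<open>decseq C\<close> unfolding decseq_def by (metis imageE nat_le_linear)
  qed (use assms in auto)
  then show ?thesis by blast
qed

text \<open>If \<open>C\<close> meets every \<open>U n\<close>, compactness gives a point of
  \<open>C\<close> in all the closures; since the closure of \<open>U (Suc n)\<close> lies in
  \<open>U n\<close>, that point is in every \<open>U n\<close>. Otherwise a point of
  \<open>C\<close> in the last \<open>U m\<close> that meets \<open>C\<close> will do, because the
  sets \<open>U n\<close> decrease. This supplies the representatives when a section is
  refined.\<close>

lemma deepest_point:
  fixes U :: "nat \<Rightarrow> 'a set"
  assumes "compact_space X" "closedin X C" "C \<noteq> {}" "\<And>n. X closure_of U (Suc n) \<subseteq> U n"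
    and "\<And>n. openin X (U n)"
  obtains x where "x \<in> C" "\<And>y n. y \<in> C \<Longrightarrow> y \<in> U n \<Longrightarrow> x \<in> U n"
proof -
  have sub: "U n \<subseteq> X closure_of U n" for n
    by (simp add: assms(5) closure_of_subset openin_subset)
  have anti: "U n \<subseteq> U m" if "m \<le> n" for m n
    using sub assms(4) by (intro lift_Suc_antimono_le[OF _ that]) blast
  show thesis
  proof (cases "\<forall>n. C \<inter> U n \<noteq> {}")
    case True
    have "\<exists>x. x \<in> \<Inter>(range (\<lambda>n. C \<inter> X closure_of U n))"
    proof (rule ccontr)
      assume "\<not> ?thesis"
      then have "\<Inter>(range (\<lambda>n. C \<inter> X closure_of U n)) \<subseteq> {}" by blast
      then have "\<exists>n. C \<inter> X closure_of U n \<subseteq> {}"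
      proof (intro compact_space_decseq_subset[OF assms(1)])
        show "decseq (\<lambda>n. C \<inter> X closure_of U n)"
          unfolding decseq_def by (intro allI impI Int_mono order_refl closure_of_mono anti)
      qed (use assms(2) in auto)
      then show False using True sub by blast
    qed
    then obtain x where "x \<in> C" "x \<in> X closure_of U (Suc n)" for n by blast
    then show thesis using that assms(4) by blast
  next
    case False
    then obtain n where n: "C \<inter> U n = {}" "\<And>m. m < n \<Longrightarrow> C \<inter> U m \<noteq> {}"
      using exists_least_iff[of "\<lambda>n. C \<inter> U n = {}"] by blast
    have less: "k < n" if "y \<in> C" "y \<in> U k" for y k
      using n(1) anti[of n k] that by (cases "k < n") auto
    show thesis
    proof (cases n)
      case 0
      \<comment> \<open>Here \<open>C\<close> misses even \<open>U 0\<close>, so the requirement is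
        vacuous and any point of \<open>C\<close> serves.\<close>
      then show thesis using that assms(3) less by blast
    next
      case (Suc m)
      then obtain x where x: "x \<in> C" "x \<in> U m" using n(2)[of m] by blast
      show thesis
      proof (rule that[OF x(1)])
        fix y k assume "y \<in> C" "y \<in> U k"
        then show "x \<in> U k" using less[of y k] anti[of k m] x Suc by auto
      qed
    qed
  qed
qed

text \<open>Countable dense subsets of the fibres over a countable dense set \<open>A\<close>
  together form a dense set: the image of a nonempty open \<open>U\<close> is open and so meets
  \<open>A\<close>, and over such a point the trace of \<open>U\<close> on the fibre is open and
  nonempty.\<close>

lemma separable_space_open_map_fibres:
  assumes "open_map X Y f" "separable_space Y"
    and fibres: "\<And>y. y \<in> topspace Y \<Longrightarrow> separable_space (subtopology X {x \<in> topspace X. f x = y})"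
  shows "separable_space X"
proof -
  obtain A where A: "countable A" "A \<subseteq> topspace Y" "Y closure_of A = topspace Y"
    using assms(2) unfolding separable_space_def by blast
  let ?F = "\<lambda>y. {x \<in> topspace X. f x = y}"
  have "\<exists>B. \<forall>y\<in>A. countable (B y) \<and> B y \<subseteq> topspace (subtopology X (?F y)) \<and>
      subtopology X (?F y) closure_of B y = topspace (subtopology X (?F y))"
    using fibres A(2) unfolding separable_space_def by (intro bchoice) blast
  then obtain B where B: "\<And>y. y \<in> A \<Longrightarrow> countable (B y)" "\<And>y. y \<in> A \<Longrightarrow> B y \<subseteq> topspace X"
    "\<And>y. y \<in> A \<Longrightarrow> subtopology X (?F y) closure_of B y = topspace (subtopology X (?F y))"
    by auto
  let ?C = "\<Union>y\<in>A. B y"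
  have "?C \<inter> U \<noteq> {}" if U: "openin X U" "U \<noteq> {}" for U
  proof -
    have "openin Y (f ` U)" "f ` U \<noteq> {}" using assms(1) U unfolding open_map_def by auto
    then obtain x where x: "x \<in> U" "f x \<in> A"
      using A(3) unfolding dense_intersects_open by blast
    have "openin (subtopology X (?F (f x))) (U \<inter> ?F (f x))"
      using U(1) by (auto simp: openin_subtopology)
    moreover have "x \<in> U \<inter> ?F (f x)" using x U(1) openin_subset by blast
    ultimately have "B (f x) \<inter> (U \<inter> ?F (f x)) \<noteq> {}"
      using B(3)[OF x(2)] unfolding dense_intersects_open by blast
    then show ?thesis using x(2) by blast
  qed
  then show ?thesis
    unfolding separable_space_def dense_intersects_open
    using A(1) B(1,2) by (intro exI[of _ ?C]) auto
qed

section \<open>Translations and neighbourhoods of the identity\<close>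

context topological_group
begin

lemma openin_carrier: "openin T U \<Longrightarrow> x \<in> U \<Longrightarrow> x \<in> carrier G"
  using openin_subset topspace_eq by blast

lemma closedin_carrier: "closedin T U \<Longrightarrow> x \<in> U \<Longrightarrow> x \<in> carrier G"
  using closedin_subset topspace_eq by blast

lemma continuous_map_mult:
  "continuous_map X T f \<Longrightarrow> continuous_map X T g \<Longrightarrow> continuous_map X T (\<lambda>x. f x \<otimes> g x)"
  using continuous_map_compose[OF continuous_map_pairedI continuous_mult] by (simp add: o_def)

lemma continuous_map_inverse:
  "continuous_map X T f \<Longrightarrow> continuous_map X T (\<lambda>x. inv (f x))"
  using continuous_map_compose[OF _ continuous_inv] by (simp add: o_def)

lemma continuous_map_translate_left: "a \<in> carrier G \<Longrightarrow> continuous_map T T (\<lambda>x. a \<otimes> x)"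
  by (rule continuous_map_mult) (auto simp: topspace_eq)

lemma continuous_map_translate_right: "a \<in> carrier G \<Longrightarrow> continuous_map T T (\<lambda>x. x \<otimes> a)"
  by (rule continuous_map_mult) (auto simp: topspace_eq)

lemma openin_translate_left:
  "openin T U \<Longrightarrow> a \<in> carrier G \<Longrightarrow> openin T {x \<in> carrier G. a \<otimes> x \<in> U}"
  using openin_continuous_map_preimage[OF continuous_map_translate_left] topspace_eq by metis

lemma openin_translate_right:
  "openin T U \<Longrightarrow> a \<in> carrier G \<Longrightarrow> openin T {x \<in> carrier G. x \<otimes> a \<in> U}"
  using openin_continuous_map_preimage[OF continuous_map_translate_right] topspace_eq by metis

lemma closedin_translate_left:
  "closedin T U \<Longrightarrow> a \<in> carrier G \<Longrightarrow> closedin T {x \<in> carrier G. a \<otimes> x \<in> U}"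
  using closedin_continuous_map_preimage[OF continuous_map_translate_left] topspace_eq by metis

lemma closedin_l_coset:
  assumes "closedin T C" "a \<in> carrier G"
  shows "closedin T (a <# C)"
proof -
  have "a <# C = {x \<in> carrier G. inv a \<otimes> x \<in> C}"
    using assms closedin_carrier[OF assms(1)] unfolding l_coset_def
    by (auto simp: m_assoc[symmetric])
  then show ?thesis using closedin_translate_left[OF assms(1)] assms by simp
qed

lemma openin_set_mult:
  assumes "openin T V" "A \<subseteq> carrier G"
  shows "openin T (V <#> A)"
proof -
  have "V <#> A = (\<Union>a\<in>A. {x \<in> carrier G. x \<otimes> inv a \<in> V})"
    using assms openin_carrier[OF assms(1)] unfolding set_mult_def
    by (fastforce simp: m_assoc subset_iff)
  moreover have "openin T {x \<in> carrier G. x \<otimes> inv a \<in> V}" if "a \<in> A" for a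
    using assms that by (intro openin_translate_right) auto
  ultimately show ?thesis by (auto intro: openin_Union)
qed

lemma subset_set_mult_one:
  assumes "\<one> \<in> V" "A \<subseteq> carrier G"
  shows "A \<subseteq> V <#> A"
proof
  fix a assume "a \<in> A"
  then have "a = \<one> \<otimes> a" using assms by auto
  then show "a \<in> V <#> A" using assms(1) \<open>a \<in> A\<close> unfolding set_mult_def by blast
qed

lemma neighbourhood_one_div:
  assumes "openin T U" "\<one> \<in> U"
  obtains V where "openin T V" "\<one> \<in> V" "\<And>x y. x \<in> V \<Longrightarrow> y \<in> V \<Longrightarrow> x \<otimes> inv y \<in> U"
proof -
  have "continuous_map (prod_topology T T) T (\<lambda>p. fst p \<otimes> inv (snd p))"
    by (intro continuous_map_mult continuous_map_inverse continuous_map_fst continuous_map_snd)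
  then have "openin (prod_topology T T) {p \<in> topspace (prod_topology T T). fst p \<otimes> inv (snd p) \<in> U}"
    using assms(1) by (rule openin_continuous_map_preimage)
  then obtain V W where "openin T V" "openin T W" "\<one> \<in> V" "\<one> \<in> W"
    "V \<times> W \<subseteq> {p \<in> topspace (prod_topology T T). fst p \<otimes> inv (snd p) \<in> U}"
    unfolding openin_prod_topology_alt using assms(2)
    by (elim allE[of _ \<one>]) (auto simp: topspace_eq)
  then show thesis
    by (intro that[of "V \<inter> W"]) (auto simp: subset_iff)
qed

text \<open>The tube lemma, applied to the preimage of \<open>U\<close> under multiplication along
  \<open>{\<one>} \<times> C\<close>. It makes an open neighbourhood of a compact set
  uniform.\<close>

lemma compactin_neighbourhood_one_mult:
  assumes "compactin T C" "openin T U" "C \<subseteq> U"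
  obtains V where "openin T V" "\<one> \<in> V" "V <#> C \<subseteq> U"
proof -
  have "openin (prod_topology T T) {p \<in> topspace (prod_topology T T). fst p \<otimes> snd p \<in> U}"
    using openin_continuous_map_preimage[OF continuous_mult assms(2)] by (simp add: case_prod_unfold)
  moreover have "{\<one>} \<times> C \<subseteq> {p \<in> topspace (prod_topology T T). fst p \<otimes> snd p \<in> U}"
    using assms openin_carrier[OF assms(2)] by (auto simp: topspace_eq subset_iff)
  ultimately have "\<exists>V W. openin T V \<and> openin T W \<and> \<one> \<in> V \<and> C \<subseteq> W \<and>
      V \<times> W \<subseteq> {p \<in> topspace (prod_topology T T). fst p \<otimes> snd p \<in> U}"
    by (intro tube_lemma_right assms(1)) (auto simp: topspace_eq)
  then obtain V W where V: "openin T V" "\<one> \<in> V" "C \<subseteq> W"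
    and VW: "V \<times> W \<subseteq> {p \<in> topspace (prod_topology T T). fst p \<otimes> snd p \<in> U}"
    by blast
  have "v \<otimes> c \<in> U" if "v \<in> V" "c \<in> C" for v c
    using subsetD[OF VW, of "(v, c)"] that V(3) by auto
  then have "V <#> C \<subseteq> U" unfolding set_mult_def by blast
  with V show thesis using that by blast
qed

section \<open>Sections that are continuous at the base point\<close>

text \<open>
  \<open>R\<close> encodes a section \<open>G/N \<rightarrow> G/P\<close>, where \<open>P = R \<inter> N\<close>: it meets every left coset of \<open>N\<close> in
  exactly one left coset of \<open>P\<close>. The last conjunct says that this section is continuous at the
  base point \<open>N\<close>.
\<close>

definition partial_section :: "'a set \<Rightarrow> 'a set \<Rightarrow> bool" where
  "partial_section N R \<longleftrightarrow> R \<subseteq> carrier G \<and> \<one> \<in> R \<and>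
     (\<forall>x\<in>R. \<forall>n\<in>N. x \<otimes> n \<in> R \<longleftrightarrow> n \<in> R) \<and>
     (\<forall>g\<in>carrier G. \<exists>n\<in>N. g \<otimes> n \<in> R) \<and>
     closedin T (R \<inter> N) \<and>
     (\<forall>V. openin T V \<and> \<one> \<in> V \<longrightarrow>
        (\<exists>W. openin T W \<and> \<one> \<in> W \<and> R \<inter> (W <#> N) \<subseteq> V <#> (R \<inter> N)))"

lemma partial_sectionD:
  assumes "partial_section N R"
  shows "R \<subseteq> carrier G" "\<one> \<in> R" "\<And>x n. x \<in> R \<Longrightarrow> n \<in> N \<Longrightarrow> x \<otimes> n \<in> R \<longleftrightarrow> n \<in> R"
    "\<And>g. g \<in> carrier G \<Longrightarrow> \<exists>n\<in>N. g \<otimes> n \<in> R" "closedin T (R \<inter> N)"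
    "\<And>V. openin T V \<Longrightarrow> \<one> \<in> V \<Longrightarrow> \<exists>W. openin T W \<and> \<one> \<in> W \<and> R \<inter> (W <#> N) \<subseteq> V <#> (R \<inter> N)"
  using assms unfolding partial_section_def by simp_all

lemma partial_section_subgroup:
  assumes "partial_section N R" "subgroup N G"
  shows "subgroup (R \<inter> N) G"
proof -
  interpret N: subgroup N G by fact
  note R = partial_sectionD[OF assms(1)]
  show ?thesis
  proof
    \<comment> \<open>The coset condition is applied to
      \<open>x \<otimes> inv x = \<one> \<in> R\<close>.\<close>
    show "inv x \<in> R \<inter> N" if "x \<in> R \<inter> N" for x
      using that R(2) R(3)[of x "inv x"] by simp
  qed (use R in auto)
qed

lemma partial_section_coset:
  assumes "partial_section N R" "subgroup N G" "x \<in> R"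
  shows "R \<inter> (x <# N) = x <# (R \<inter> N)"
  using partial_sectionD(3)[OF assms(1,3)] unfolding l_coset_def by blast

text \<open>Closedness is part of \<open>partial_section\<close> for \<open>R \<inter> N\<close>
  alone, but on every left coset of \<open>N\<close> the set \<open>R\<close> is a left translate of
  \<open>R \<inter> N\<close>. So compactness can be used coset by coset.\<close>

lemma closedin_partial_section_coset:
  assumes "partial_section N R" "subgroup N G" "g \<in> carrier G"
  shows "closedin T (R \<inter> (g <# N))"
proof -
  interpret N: subgroup N G by fact
  obtain n where n: "n \<in> N" "g \<otimes> n \<in> R" using partial_sectionD(4)[OF assms(1,3)] by blast
  have "g \<otimes> n \<in> g <# N" using n by (auto simp: l_coset_def)
  then have "g <# N = (g \<otimes> n) <# N" using assms(3,2) by (rule l_repr_independence)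
  then have "R \<inter> (g <# N) = (g \<otimes> n) <# (R \<inter> N)"
    using partial_section_coset[OF assms(1,2) n(2)] by (simp only:)
  then show ?thesis
    using closedin_l_coset[OF partial_sectionD(5)[OF assms(1)], of "g \<otimes> n"] assms(3) N.mem_carrier[OF n(1)]
    by simp
qed

text \<open>This is the coarsest section, the identity of \<open>G/N\<close>, with
  \<open>P = N\<close>. It makes the family in the Zorn argument nonempty.\<close>

lemma partial_section_self:
  assumes "subgroup N G" "closedin T N"
  shows "partial_section N (carrier G)"
proof -
  interpret N: subgroup N G by fact
  have "carrier G \<inter> N = N" by auto
  then show ?thesis
    unfolding partial_section_def
  proof (intro conjI ballI allI impI)
    fix g assume "g \<in> carrier G"
    then show "\<exists>n\<in>N. g \<otimes> n \<in> carrier G" using N.one_closed by blast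
  next
    fix V assume "openin T V \<and> \<one> \<in> V"
    then show "\<exists>W. openin T W \<and> \<one> \<in> W \<and> carrier G \<inter> (W <#> N) \<subseteq> V <#> (carrier G \<inter> N)"
      using \<open>carrier G \<inter> N = N\<close> by auto
  qed (use assms(2) in auto)
qed

text \<open>Bounds for chains in the Zorn argument. Compactness enters twice: the traces of the
  members of \<open>\<R>\<close> on a coset of \<open>N\<close> are closed, nonempty and form a
  chain, so they have a common point; and the open set
  \<open>V <#> (\<Inter>\<R> \<inter> N)\<close> already contains \<open>R \<inter> N\<close> for a
  single \<open>R\<close>, whose continuity at the base point then passes to the
  intersection.\<close>

lemma partial_section_Inter:
  assumes "compact_space T" "subgroup N G" "\<R> \<noteq> {}"
    and sect: "\<And>R. R \<in> \<R> \<Longrightarrow> partial_section N R"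
    and chain: "\<And>A B. A \<in> \<R> \<Longrightarrow> B \<in> \<R> \<Longrightarrow> A \<subseteq> B \<or> B \<subseteq> A"
  shows "partial_section N (\<Inter>\<R>)"
proof -
  interpret N: subgroup N G by fact
  note R = partial_sectionD[OF sect]
  have transversal: "\<exists>n\<in>N. g \<otimes> n \<in> \<Inter>\<R>" if g: "g \<in> carrier G" for g
  proof (rule ccontr)
    assume "\<not> ?thesis"
    then have empty: "\<Inter>((\<lambda>R. R \<inter> (g <# N)) ` \<R>) \<subseteq> {}"
      using \<open>\<R> \<noteq> {}\<close> unfolding l_coset_def by blast
    have closed: "closedin T (R \<inter> (g <# N))" if R: "R \<in> \<R>" for R
      using sect[OF R] assms(2) g by (rule closedin_partial_section_coset)
    have "\<exists>C\<in>(\<lambda>R. R \<inter> (g <# N)) ` \<R>. C \<subseteq> {}"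
    proof (rule compact_space_chain_subset[OF assms(1)])
      show "A \<subseteq> B \<or> B \<subseteq> A" if "A \<in> (\<lambda>R. R \<inter> (g <# N)) ` \<R>" "B \<in> (\<lambda>R. R \<inter> (g <# N)) ` \<R>" for A B
        using that chain by blast
    qed (use closed empty \<open>\<R> \<noteq> {}\<close> in auto)
    then obtain R where "R \<in> \<R>" "R \<inter> (g <# N) = {}" by blast
    then show False using R(4)[OF _ g] unfolding l_coset_def by blast
  qed
  have closed: "closedin T (\<Inter>\<R> \<inter> N)"
  proof -
    have eq: "\<Inter>\<R> \<inter> N = \<Inter>((\<lambda>R. R \<inter> N) ` \<R>)" using \<open>\<R> \<noteq> {}\<close> by blast
    show ?thesis unfolding eq by (rule closedin_Inter) (use R(5) \<open>\<R> \<noteq> {}\<close> in auto)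
  qed
  have continuous: "\<exists>W. openin T W \<and> \<one> \<in> W \<and> \<Inter>\<R> \<inter> (W <#> N) \<subseteq> V <#> (\<Inter>\<R> \<inter> N)"
    if V: "openin T V" "\<one> \<in> V" for V
  proof -
    let ?O = "V <#> (\<Inter>\<R> \<inter> N)"
    have "openin T ?O" using V by (intro openin_set_mult) auto
    moreover have "\<Inter>((\<lambda>R. R \<inter> N) ` \<R>) \<subseteq> ?O"
    proof
      fix x assume "x \<in> \<Inter>((\<lambda>R. R \<inter> N) ` \<R>)"
      then have "x \<in> \<Inter>\<R> \<inter> N" using \<open>\<R> \<noteq> {}\<close> by blast
      then show "x \<in> ?O" using subset_set_mult_one[OF V(2), of "\<Inter>\<R> \<inter> N"] N.subset by blast
    qed
    ultimately have "\<exists>C\<in>(\<lambda>R. R \<inter> N) ` \<R>. C \<subseteq> ?O"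
    proof (intro compact_space_chain_subset[OF assms(1)])
      show "A \<subseteq> B \<or> B \<subseteq> A" if "A \<in> (\<lambda>R. R \<inter> N) ` \<R>" "B \<in> (\<lambda>R. R \<inter> N) ` \<R>" for A B
        using that chain by blast
    qed (use R(5) \<open>\<R> \<noteq> {}\<close> in auto)
    then obtain R where R': "R \<in> \<R>" "R \<inter> N \<subseteq> ?O" by blast
    \<comment> \<open>Continuity of \<open>R\<close> bounds points only by
      \<open>V' <#> (R \<inter> N)\<close>, so some room around the compact set
      \<open>R \<inter> N\<close> inside \<open>?O\<close> is required.\<close>
    obtain V' where V': "openin T V'" "\<one> \<in> V'" "V' <#> (R \<inter> N) \<subseteq> ?O"
      using compactin_neighbourhood_one_mult[OF closedin_compact_space[OF assms(1) R(5)[OF R'(1)]]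
          \<open>openin T ?O\<close> R'(2)] by blast
    then show ?thesis using R(6)[OF R'(1) V'(1,2)] R'(1) by blast
  qed
  show ?thesis
    unfolding partial_section_def
  proof (intro conjI ballI allI impI)
    show "\<Inter>\<R> \<subseteq> carrier G" using R(1) \<open>\<R> \<noteq> {}\<close> by blast
    show "\<one> \<in> \<Inter>\<R>" using R(2) by blast
    show "x \<otimes> n \<in> \<Inter>\<R> \<longleftrightarrow> n \<in> \<Inter>\<R>" if "x \<in> \<Inter>\<R>" "n \<in> N" for x n
      using R(3) that by (meson Inter_iff)
  qed (use transversal closed continuous in simp_all)
qed

section \<open>Refining a section so as to exclude a given point\<close>

text \<open>Dependent choice, starting from a neighbourhood of \<open>\<one>\<close> separated from
  \<open>p\<close>. The last condition makes the intersection of all \<open>U n\<close> a closed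
  subgroup, and \<open>p \<notin> U 0\<close> keeps \<open>p\<close> out of it.\<close>

lemma subgroup_sequence_avoiding:
  assumes "p \<in> carrier G" "p \<noteq> \<one>"
  obtains U :: "nat \<Rightarrow> 'a set" where "\<And>n. openin T (U n)" "\<And>n. \<one> \<in> U n" "p \<notin> U 0"
    "\<And>n x y. x \<in> U (Suc n) \<Longrightarrow> y \<in> U (Suc n) \<Longrightarrow> x \<otimes> inv y \<in> U n"
proof -
  let ?P = "\<lambda>V. openin T V \<and> \<one> \<in> V \<and> p \<notin> V"
  have "\<exists>U :: nat \<Rightarrow> 'a set. \<forall>n. ?P (U n) \<and> (\<forall>x\<in>U (Suc n). \<forall>y\<in>U (Suc n). x \<otimes> inv y \<in> U n)"
  proof (rule dependent_nat_choice)
    show "\<exists>V. ?P V"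
    proof -
      obtain V W where "openin T V" "openin T W" "\<one> \<in> V" "p \<in> W" "disjnt V W"
        using Hausdorff assms one_closed unfolding Hausdorff_space_def topspace_eq by blast
      then show ?thesis unfolding disjnt_iff by blast
    qed
    fix U assume U: "?P U"
    then obtain V where V: "openin T V" "\<one> \<in> V" "\<And>x y. x \<in> V \<Longrightarrow> y \<in> V \<Longrightarrow> x \<otimes> inv y \<in> U"
      using neighbourhood_one_div[of U] by blast
    \<comment> \<open>Avoidance of \<open>p\<close> is inherited: if \<open>p\<close> were in
      \<open>V\<close>, then \<open>p \<otimes> inv \<one>\<close> would lie in
      \<open>U\<close>.\<close>
    have "p \<otimes> inv \<one> = p" using assms by simp
    then have "p \<notin> V" using V(2) V(3)[of p \<one>] U by auto
    with V show "\<exists>V. ?P V \<and> (\<forall>x\<in>V. \<forall>y\<in>V. x \<otimes> inv y \<in> U)" by blast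
  qed
  then obtain U :: "nat \<Rightarrow> 'a set" where
    "\<forall>n. ?P (U n) \<and> (\<forall>x\<in>U (Suc n). \<forall>y\<in>U (Suc n). x \<otimes> inv y \<in> U n)" ..
  then show thesis using that[of U] by blast
qed

text \<open>For \<open>z\<close> in the closure, the translate of \<open>V\<close> by
  \<open>z\<close> is a neighbourhood of \<open>z\<close> and contains some
  \<open>y \<in> V\<close>; then \<open>z\<close> is the quotient
  \<open>y \<otimes> inv (inv z \<otimes> y)\<close> of two elements of \<open>V\<close>.\<close>

lemma closure_of_subset_div:
  assumes V: "openin T V" "\<one> \<in> V" and div: "\<And>x y. x \<in> V \<Longrightarrow> y \<in> V \<Longrightarrow> x \<otimes> inv y \<in> U"
  shows "T closure_of V \<subseteq> U"
proof
  fix z assume z: "z \<in> T closure_of V"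
  then have zc: "z \<in> carrier G" by (simp add: in_closure_of topspace_eq)
  have "openin T {x \<in> carrier G. inv z \<otimes> x \<in> V}" using V(1) zc by (simp add: openin_translate_left)
  moreover have "z \<in> {x \<in> carrier G. inv z \<otimes> x \<in> V}" using zc V(2) by simp
  ultimately have "\<exists>y\<in>V. y \<in> {x \<in> carrier G. inv z \<otimes> x \<in> V}"
    using z unfolding in_closure_of by metis
  then obtain y where y: "y \<in> V" "y \<in> carrier G" "inv z \<otimes> y \<in> V" by blast
  have "y \<otimes> inv (inv z \<otimes> y) = y \<otimes> (inv y \<otimes> z)"
    using y(2) zc by (simp add: inv_mult_group)
  also have "\<dots> = z" using y(2) zc by (simp flip: m_assoc)
  finally show "z \<in> U" using div[OF y(1,3)] by simp
qed


text \<open>The refinement step of the Zorn argument. Passing from cosets of \<open>P\<close> to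
  cosets of \<open>P' = P \<inter> Q\<close> discards \<open>p\<close>, as \<open>Q\<close> is a
  closed subgroup without \<open>p\<close>. The delicate point is to choose the new cosets so that
  continuity at the base point survives, although \<open>Q\<close> need not be open.\<close>

lemma partial_section_refine:
  assumes "compact_space T" "subgroup N G" "partial_section N R" "p \<in> R \<inter> N" "p \<noteq> \<one>"
  obtains R' where "partial_section N R'" "R' \<subseteq> R" "p \<notin> R'"
proof -
  interpret N: subgroup N G by fact
  note R = partial_sectionD[OF assms(3)]
  obtain U :: "nat \<Rightarrow> 'a set" where U: "\<And>n. openin T (U n)" "\<And>n. \<one> \<in> U n" "p \<notin> U 0"
    and div: "\<And>n x y. x \<in> U (Suc n) \<Longrightarrow> y \<in> U (Suc n) \<Longrightarrow> x \<otimes> inv y \<in> U n"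
    using subgroup_sequence_avoiding[of p] assms(4,5) N.mem_carrier by auto
  have closure: "T closure_of U (Suc n) \<subseteq> U n" for n
    using U(1,2) div by (rule closure_of_subset_div)
  have sub: "U n \<subseteq> T closure_of U n" for n
    by (simp add: U(1) closure_of_subset openin_subset)
  define Q where "Q = (\<Inter>n. U n)"
  have Q: "Q = (\<Inter>n. T closure_of U n)"
    unfolding Q_def using closure sub by blast
  have "closedin T Q" unfolding Q by auto
  have "subgroup Q G"
  proof (rule subgroupI)
    show "Q \<subseteq> carrier G" using openin_carrier[OF U(1)] unfolding Q_def by blast
    show "Q \<noteq> {}" using U(2) unfolding Q_def by blast
    have QQ: "a \<otimes> inv b \<in> Q" if "a \<in> Q" "b \<in> Q" for a b
      using that div unfolding Q_def by blast
    show inv: "inv a \<in> Q" if "a \<in> Q" for a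
    proof -
      have "\<one> \<otimes> inv a \<in> Q" using that U(2) by (intro QQ) (auto simp: Q_def)
      then show ?thesis using that \<open>Q \<subseteq> carrier G\<close> by auto
    qed
    show "a \<otimes> b \<in> Q" if "a \<in> Q" "b \<in> Q" for a b
      using QQ[OF that(1) inv[OF that(2)]] that \<open>Q \<subseteq> carrier G\<close> by auto
  qed
  define P where "P = R \<inter> N"
  define P' where "P' = P \<inter> Q"
  have P: "subgroup P G" unfolding P_def by (rule partial_section_subgroup) fact+
  then interpret P: subgroup P G .
  have P'G: "subgroup P' G" unfolding P'_def using P \<open>subgroup Q G\<close> by (rule subgroups_Inter_pair)
  then interpret P': subgroup P' G .
  have P'N: "P' \<subseteq> N" "P' \<subseteq> R" "P' \<subseteq> P" unfolding P'_def P_def by auto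
  have P'c: "closedin T P'" unfolding P'_def P_def using R(5) \<open>closedin T Q\<close> by blast
  have coset: "x <# N = g <# N" if "x \<in> g <# N" "g \<in> carrier G" for x g
    using l_repr_independence[OF that N.subgroup_axioms] by simp
  txt \<open>
    In every coset of \<open>P\<close> we choose a representative lying in as many \<open>U n\<close> as possible. Near the
    base point, these representatives are then close to \<open>\<Inter>n. U n\<close>.
  \<close>
  have "\<exists>z. z \<in> R \<inter> D \<and> (\<forall>y n. y \<in> R \<inter> D \<longrightarrow> y \<in> U n \<longrightarrow> z \<in> U n)"
    if D: "D \<in> (\<lambda>g. g <# N) ` carrier G" for D
  proof -
    obtain g where g: "g \<in> carrier G" "D = g <# N" using D by blast
    obtain n where n: "n \<in> N" "g \<otimes> n \<in> R" using R(4)[OF g(1)] ..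
    then have "g \<otimes> n \<in> R \<inter> D" unfolding g(2) l_coset_def by blast
    then have "R \<inter> D \<noteq> {}" by auto
    moreover have "closedin T (R \<inter> D)"
      unfolding g(2) using assms(3,2) g(1) by (rule closedin_partial_section_coset)
    ultimately show ?thesis
      using deepest_point[where X = T and C = "R \<inter> D" and U = U] assms(1) closure U(1) by metis
  qed
  then have "\<exists>d. \<forall>D\<in>(\<lambda>g. g <# N) ` carrier G.
      d D \<in> R \<inter> D \<and> (\<forall>y n. y \<in> R \<inter> D \<longrightarrow> y \<in> U n \<longrightarrow> d D \<in> U n)"
    by (intro bchoice ballI)
  then obtain d where d: "\<And>g. g \<in> carrier G \<Longrightarrow> d (g <# N) \<in> R \<inter> (g <# N)"
    "\<And>g y n. g \<in> carrier G \<Longrightarrow> y \<in> R \<inter> (g <# N) \<Longrightarrow> y \<in> U n \<Longrightarrow> d (g <# N) \<in> U n"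
    by auto
  \<comment> \<open>The value \<open>\<one>\<close> on \<open>N\<close> puts \<open>\<one>\<close>
    into the new section; it lies in every \<open>U n\<close>, so it is a deepest point as well.
    Everywhere \<open>c x\<close> depends only on the coset of \<open>x\<close>.\<close>
  define c where "c x = (if x \<in> N then \<one> else d (x <# N))" for x
  have cN: "x <# N = N" if "x \<in> N" for x
    using coset_join3[OF N.mem_carrier[OF that] N.subgroup_axioms that] .
  have cR: "c x \<in> R" if "x \<in> carrier G" for x
    using d(1)[OF that] R(2) unfolding c_def by simp
  have c_coset: "c x \<in> x <# N" if "x \<in> carrier G" for x
    using d(1)[OF that] cN[of x] N.one_closed unfolding c_def by simp
  have c_deep: "c x \<in> U n" if "x \<in> carrier G" "y \<in> R" "y \<in> x <# N" "y \<in> U n" for x y n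
    using d(2)[OF that(1) _ that(4)] that(2,3) U(2) unfolding c_def by simp
  have c_eq: "c (x \<otimes> n) = c x" if "x \<in> carrier G" "n \<in> N" for x n
  proof -
    have "x \<otimes> n \<in> x <# N" using that by (auto simp: l_coset_def)
    then have "(x \<otimes> n) <# N = x <# N" using that(1) by (rule coset)
    moreover have "x \<otimes> n \<in> N \<longleftrightarrow> x \<in> N"
    proof
      assume "x \<otimes> n \<in> N"
      then have "(x \<otimes> n) \<otimes> inv n \<in> N" using that(2) by simp
      then show "x \<in> N" using that by (simp add: m_assoc)
    qed (use that in simp)
    ultimately show ?thesis unfolding c_def by simp
  qed
  have cc: "c x \<in> carrier G" if "x \<in> carrier G" for x using cR[OF that] R(1) by blast
  \<comment> \<open>\<open>R'\<close> meets each coset \<open>x <# N\<close> exactly in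
    \<open>c x <# P'\<close>.\<close>
  define R' where "R' = {x \<in> carrier G. inv (c x) \<otimes> x \<in> P'}"
  have R'N: "R' \<inter> N = P'"
    using P'N(1) N.mem_carrier by (auto simp: R'_def c_def)
  have "R' \<subseteq> R"
  proof
    fix x assume x: "x \<in> R'"
    then have "c x \<otimes> (inv (c x) \<otimes> x) \<in> R"
      using R(3)[OF cR, of x "inv (c x) \<otimes> x"] P'N unfolding R'_def by blast
    then show "x \<in> R" using x cc[of x] by (simp add: R'_def m_assoc[symmetric])
  qed
  moreover have "p \<notin> R'"
    using R'N assms(4) U(3) unfolding P'_def Q_def by blast
  moreover have "partial_section N R'"
    unfolding partial_section_def R'N
  proof (intro conjI ballI allI impI)
    show "R' \<subseteq> carrier G" unfolding R'_def by blast
    show "\<one> \<in> R'" using R'N P'.one_closed by blast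
    show "closedin T P'" by fact
  next
    fix x n assume x: "x \<in> R'" and n: "n \<in> N"
    have xc: "x \<in> carrier G" "inv (c x) \<otimes> x \<in> P'" using x unfolding R'_def by auto
    have "inv (c (x \<otimes> n)) \<otimes> (x \<otimes> n) = (inv (c x) \<otimes> x) \<otimes> n"
      using xc n cc by (simp add: c_eq m_assoc)
    moreover have "(inv (c x) \<otimes> x) \<otimes> n \<in> P' \<longleftrightarrow> n \<in> P'"
    proof
      assume "(inv (c x) \<otimes> x) \<otimes> n \<in> P'"
      then have "inv (inv (c x) \<otimes> x) \<otimes> ((inv (c x) \<otimes> x) \<otimes> n) \<in> P'" using xc(2) by blast
      then show "n \<in> P'" using P'.mem_carrier[OF xc(2)] n by (simp add: m_assoc[symmetric])
    qed (use xc(2) in blast)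
    moreover have "n \<in> R' \<longleftrightarrow> n \<in> P'" using R'N n by blast
    moreover have "x \<otimes> n \<in> carrier G" using xc(1) n by simp
    ultimately show "x \<otimes> n \<in> R' \<longleftrightarrow> n \<in> R'" by (simp add: R'_def)
  next
    fix g assume g: "g \<in> carrier G"
    obtain n where n: "n \<in> N" "c g = g \<otimes> n" using c_coset[OF g] unfolding l_coset_def by blast
    then have "c (g \<otimes> n) = g \<otimes> n" using c_eq g by simp
    then have "g \<otimes> n \<in> R'" using g n unfolding R'_def by simp
    then show "\<exists>n\<in>N. g \<otimes> n \<in> R'" using n by blast
  next
    fix V assume V: "openin T V \<and> \<one> \<in> V"
    let ?O = "V <#> P'"
    have O: "openin T ?O" using V P'.subset by (intro openin_set_mult) auto
    have "P' \<subseteq> ?O" using V P'.subset by (intro subset_set_mult_one) auto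
    then have "\<Inter>(range (\<lambda>n. P \<inter> T closure_of U n)) \<subseteq> ?O"
      unfolding P'_def Q by blast
    then have "\<exists>n. P \<inter> T closure_of U n \<subseteq> ?O"
    proof (intro compact_space_decseq_subset[OF assms(1) _ _ O])
      have "U n \<subseteq> U m" if "m \<le> n" for m n
        using sub closure by (intro lift_Suc_antimono_le[OF _ that]) blast
      then show "decseq (\<lambda>n. P \<inter> T closure_of U n)"
        unfolding decseq_def by (intro allI impI Int_mono order_refl closure_of_mono)
    qed (use R(5) P_def in auto)
    then obtain n where n: "P \<inter> T closure_of U n \<subseteq> ?O" ..
    \<comment> \<open>By the choice of \<open>n\<close> this open set contains all of
      \<open>P\<close>. Conversely, a point of \<open>?O'\<close> that lies in \<open>U n\<close>
      must lie in \<open>?O\<close>; this is how \<open>c x\<close> will be placed in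
      \<open>?O\<close>.\<close>
    let ?O' = "?O \<union> (topspace T - T closure_of U n)"
    have O': "openin T ?O'" using O by (intro openin_Un openin_diff) auto
    have "P \<subseteq> ?O'" using n P.subset unfolding topspace_eq by blast
    have "compactin T P" using assms(1) R(5) unfolding P_def by (rule closedin_compact_space)
    then obtain V' where V': "openin T V'" "\<one> \<in> V'" "V' <#> P \<subseteq> ?O'"
      using O' \<open>P \<subseteq> ?O'\<close> by (rule compactin_neighbourhood_one_mult)
    \<comment> \<open>In \<open>c x = v \<otimes> a\<close> with \<open>a \<in> P\<close>, the
      factor \<open>v\<close> is used twice. Membership in \<open>V'\<close> puts \<open>c x\<close>
      into \<open>?O'\<close>. Moreover \<open>v = c x \<otimes> inv a\<close> is a point of
      \<open>R\<close> in the coset of \<open>x\<close>, so \<open>v \<in> U n\<close> forces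
      \<open>c x \<in> U n\<close> by the choice of \<open>c\<close>.\<close>
    have "openin T (V' \<inter> U n)" "\<one> \<in> V' \<inter> U n" using V' U by auto
    then obtain W where W: "openin T W" "\<one> \<in> W" "R \<inter> (W <#> N) \<subseteq> (V' \<inter> U n) <#> P"
      using R(6) unfolding P_def by blast
    have "R' \<inter> (W <#> N) \<subseteq> ?O"
    proof
      fix x assume x: "x \<in> R' \<inter> (W <#> N)"
      then have xc: "x \<in> carrier G" and q: "inv (c x) \<otimes> x \<in> P'" unfolding R'_def by auto
      define q where "q = inv (c x) \<otimes> x"
      have xq: "x = c x \<otimes> q" unfolding q_def using xc cc by (simp add: m_assoc[symmetric])
      obtain w m where w: "w \<in> W" "m \<in> N" "x = w \<otimes> m" using x unfolding set_mult_def by blast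
      have wc: "w \<in> carrier G" using openin_carrier[OF W(1) w(1)] .
      obtain k where k: "k \<in> N" "c x = x \<otimes> k" using c_coset[OF xc] unfolding l_coset_def by blast
      have "c x = w \<otimes> (m \<otimes> k)" using k w wc by (simp add: m_assoc)
      then have "c x \<in> W <#> N" using k w unfolding set_mult_def by blast
      then have "c x \<in> (V' \<inter> U n) <#> P" using W(3) cR[OF xc] by blast
      then obtain v a where v: "v \<in> V'" "v \<in> U n" "a \<in> P" "c x = v \<otimes> a"
        unfolding set_mult_def by blast
      have vc: "v \<in> carrier G" using openin_carrier[OF U(1) v(2)] .
      have va: "v = c x \<otimes> inv a" using v(3,4) vc by (simp add: m_assoc)
      have "inv a \<in> P" using v(3) by simp
      then have "v \<in> R" using R(3)[OF cR[OF xc], of "inv a"] va unfolding P_def by simp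
      moreover have "v = x \<otimes> (k \<otimes> inv a)" using va k xc v(3) by (simp add: m_assoc)
      then have "v \<in> x <# N" using k v(3) \<open>inv a \<in> P\<close> unfolding l_coset_def P_def by blast
      ultimately have "c x \<in> U n" using c_deep[OF xc] v(2) by blast
      moreover have "c x \<in> ?O'" using V'(3) v unfolding set_mult_def by blast
      ultimately have "c x \<in> ?O" using sub by blast
      \<comment> \<open>Returning from \<open>c x\<close> to \<open>x = c x \<otimes> q\<close>
        multiplies by an element of \<open>P'\<close>, which \<open>?O\<close> absorbs.\<close>
      then obtain v' b where "v' \<in> V" "b \<in> P'" "c x = v' \<otimes> b" unfolding set_mult_def by blast
      moreover have "v' \<in> carrier G" using openin_carrier V \<open>v' \<in> V\<close> by blast
      ultimately have "x = v' \<otimes> (b \<otimes> q)" "b \<otimes> q \<in> P'"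
        using xq q unfolding q_def[symmetric] by (auto simp: m_assoc)
      then show "x \<in> ?O" using \<open>v' \<in> V\<close> unfolding set_mult_def by blast
    qed
    then show "\<exists>W. openin T W \<and> \<one> \<in> W \<and> R' \<inter> (W <#> N) \<subseteq> ?O" using W by blast
  qed
  ultimately show thesis using that by blast
qed

section \<open>Full sections, and separability of closed subgroups of compact groups\<close>

text \<open>Zorn's lemma is applied to complements, so that refining \<open>R\<close> means
  enlarging \<open>M\<close>. Maximality of \<open>M\<close> leaves only \<open>\<one>\<close> in
  \<open>R \<inter> N\<close>, since any other point could be removed by a refinement.\<close>

lemma section_continuous_at_one:
  assumes "compact_space T" "subgroup N G" "closedin T N"
  obtains R where "partial_section N R" "R \<inter> N = {\<one>}"
proof -
  let ?A = "(\<lambda>R. carrier G - R) ` {R. partial_section N R}"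
  have sect: "partial_section N (carrier G - X)" if X: "X \<in> ?A" for X
  proof -
    obtain R where R: "partial_section N R" "X = carrier G - R" using X by blast
    then have "carrier G - X = R" using partial_sectionD(1)[OF R(1)] by blast
    then show ?thesis using R(1) by simp
  qed
  have "\<exists>M\<in>?A. \<forall>X\<in>?A. M \<subseteq> X \<longrightarrow> X = M"
  proof (rule subset_Zorn_nonempty)
    show "?A \<noteq> {}" using partial_section_self[OF assms(2,3)] by blast
    fix \<C> assume \<C>: "\<C> \<noteq> {}" "subset.chain ?A \<C>"
    let ?R = "(\<lambda>X. carrier G - X) ` \<C>"
    have sub: "\<C> \<subseteq> ?A" and chain: "\<And>X Y. X \<in> \<C> \<Longrightarrow> Y \<in> \<C> \<Longrightarrow> X \<subseteq> Y \<or> Y \<subseteq> X"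
      using \<C>(2) unfolding subset_chain_def by auto
    have "partial_section N (\<Inter>?R)"
    proof (rule partial_section_Inter[OF assms(1,2)])
      show "partial_section N R" if "R \<in> ?R" for R using that sub sect by blast
      show "A \<subseteq> B \<or> B \<subseteq> A" if "A \<in> ?R" "B \<in> ?R" for A B using that chain by blast
    qed (use \<C>(1) in blast)
    moreover have "\<Union>\<C> = carrier G - \<Inter>?R" using sub \<C>(1) by blast
    ultimately show "\<Union>\<C> \<in> ?A" by blast
  qed
  then obtain M where M: "M \<in> ?A" "\<And>X. X \<in> ?A \<Longrightarrow> M \<subseteq> X \<Longrightarrow> X = M" by blast
  define R where "R = carrier G - M"
  have R: "partial_section N R" unfolding R_def using sect[OF M(1)] .
  have "p = \<one>" if p: "p \<in> R \<inter> N" for p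
  proof (rule ccontr)
    assume "p \<noteq> \<one>"
    then obtain R' where R': "partial_section N R'" "R' \<subseteq> R" "p \<notin> R'"
      using partial_section_refine[OF assms(1,2) R p] by blast
    have "M \<subseteq> carrier G - R'" using M(1) R'(2) unfolding R_def by blast
    then have "carrier G - R' = M" using M(2)[of "carrier G - R'"] R'(1) by blast
    then show False using p R'(3) unfolding R_def by blast
  qed
  moreover have "\<one> \<in> R \<inter> N" using partial_sectionD(2)[OF R] subgroup.one_closed[OF assms(2)] by blast
  ultimately have "R \<inter> N = {\<one>}" by blast
  with R show thesis by (rule that)
qed

text \<open>As \<open>R \<inter> N\<close> is trivial, \<open>g \<otimes> n g\<close> is the only
  point of \<open>R\<close> in the coset of \<open>g\<close>, and \<open>inv (n g)\<close> is the
  value of the retraction at \<open>g\<close>. For \<open>a\<close> close to a point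
  \<open>x\<close> of \<open>N\<close>, continuity at the base point makes
  \<open>a \<otimes> n a\<close> close to \<open>\<one>\<close>, hence \<open>inv (n a)\<close>
  close to \<open>x\<close>.\<close>

lemma separable_closed_subgroup:
  assumes "compact_space T" "separable_space T" "subgroup N G" "closedin T N"
  shows "separable_space (subtopology T N)"
proof -
  interpret N: subgroup N G by fact
  obtain R where "partial_section N R" and RN: "R \<inter> N = {\<one>}"
    using section_continuous_at_one[OF assms(1,3,4)] .
  note R = partial_sectionD[OF this(1)]
  obtain n where n: "\<And>g. g \<in> carrier G \<Longrightarrow> n g \<in> N" "\<And>g. g \<in> carrier G \<Longrightarrow> g \<otimes> n g \<in> R"
    using R(4) by metis
  obtain A where A: "countable A" "A \<subseteq> carrier G" "T closure_of A = topspace T"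
    using assms(2) unfolding separable_space_def topspace_eq by blast
  let ?B = "(\<lambda>a. inv (n a)) ` A"
  have "?B \<subseteq> N" using n(1) A(2) by auto
  moreover have "?B \<inter> Y \<noteq> {}" if Y: "openin (subtopology T N) Y" "Y \<noteq> {}" for Y
  proof -
    obtain U where U: "openin T U" "Y = U \<inter> N" using Y(1) unfolding openin_subtopology by blast
    obtain x where x: "x \<in> U" "x \<in> N" using Y(2) U(2) by blast
    then have xc: "x \<in> carrier G" by simp
    define U' where "U' = {y \<in> carrier G. y \<otimes> x \<in> U}"
    have "openin T U'" "\<one> \<in> U'"
      unfolding U'_def using openin_translate_right[OF U(1) xc] x xc by simp_all
    then obtain V where V: "openin T V" "\<one> \<in> V" "\<And>y z. y \<in> V \<Longrightarrow> z \<in> V \<Longrightarrow> y \<otimes> inv z \<in> U'"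
      using neighbourhood_one_div[of U'] by blast
    \<comment> \<open>\<open>V'\<close> consists of the inverses of elements of \<open>V\<close>,
      because the element needed in \<open>U'\<close> is
      \<open>inv s \<otimes> (a \<otimes> inv x)\<close>, a quotient of the inverses of
      \<open>s\<close> and \<open>a \<otimes> inv x\<close>.\<close>
    define V' where "V' = {y \<in> topspace T. inv y \<in> V}"
    have V': "openin T V'" "\<one> \<in> V'"
      unfolding V'_def using V openin_continuous_map_preimage[OF continuous_inv V(1)]
      by (simp_all add: topspace_eq)
    obtain W where W: "openin T W" "\<one> \<in> W" "R \<inter> (W <#> N) \<subseteq> V' <#> {\<one>}"
      using R(6)[OF V'] unfolding RN by blast
    have "openin T {y \<in> carrier G. y \<otimes> inv x \<in> W \<inter> V'}"
      using W(1) V'(1) xc by (intro openin_translate_right) auto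
    moreover have "x \<in> {y \<in> carrier G. y \<otimes> inv x \<in> W \<inter> V'}" using W(2) V'(2) xc by simp
    ultimately obtain a where a: "a \<in> A" "a \<otimes> inv x \<in> W" "a \<otimes> inv x \<in> V'"
      using A(3) unfolding dense_intersects_open by blast
    have ac: "a \<in> carrier G" "n a \<in> carrier G" using a(1) A(2) n(1) by auto
    define s where "s = a \<otimes> n a"
    have sc: "s \<in> carrier G" "s \<in> R" unfolding s_def using ac n(2) by auto
    have "s = (a \<otimes> inv x) \<otimes> (x \<otimes> n a)"
      unfolding s_def using ac xc by (simp add: m_assoc inv_solve_left)
    moreover have "x \<otimes> n a \<in> N" using x(2) n(1)[OF ac(1)] by simp
    ultimately have "s \<in> W <#> N" using a(2) unfolding set_mult_def by blast
    then have "s \<in> V' <#> {\<one>}" using W(3) sc(2) by blast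
    then obtain v where "v \<in> V'" "s = v \<otimes> \<one>" unfolding set_mult_def by blast
    then have "s \<in> V'" using openin_carrier[OF V'(1)] by simp
    then have "inv s \<otimes> inv (inv (a \<otimes> inv x)) \<in> U'"
      using a(3) unfolding V'_def by (intro V(3)) auto
    moreover have "inv s \<otimes> inv (inv (a \<otimes> inv x)) \<otimes> x = inv (n a)"
      unfolding s_def using ac xc by (simp add: m_assoc inv_mult_group)
    ultimately have "inv (n a) \<in> U" unfolding U'_def by simp
    then have "inv (n a) \<in> ?B \<inter> Y" using a(1) n(1)[OF ac(1)] U(2) by simp
    then show ?thesis by blast
  qed
  ultimately show ?thesis
    unfolding separable_space_def dense_intersects_open
    using A(1) N.subset by (intro exI[of _ ?B]) (auto simp: topspace_eq)
qed

end

section \<open>Closed subgroups of a product with a compact factor\<close>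

theorem theorem2p1:
  fixes G :: "('a, 'm) monoid_scheme" and S :: "'a topology"
    and H :: "('b, 'n) monoid_scheme" and T :: "'b topology"
  assumes "topological_group G S" and "compact_space S" and "separable_space S"
    and "topological_group H T"
    and "\<And>K. \<lbrakk>subgroup K H; closedin T K\<rbrakk> \<Longrightarrow> separable_space (subtopology T K)"
  shows "\<forall>D. subgroup D (G \<times>\<times> H) \<and> closedin (prod_topology S T) D
           \<longrightarrow> separable_space (subtopology (prod_topology S T) D)"
proof (intro allI impI, elim conjE)
  fix D assume D: "subgroup D (G \<times>\<times> H)" "closedin (prod_topology S T) D"
  interpret G: topological_group G S by fact
  interpret H: topological_group H T by fact
  interpret P: topological_group "G \<times>\<times> H" "prod_topology S T"
    using assms(1,4) by (rule topological_group_DirProd)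
  have DC: "g \<in> carrier G" "h \<in> carrier H" if "(g, h) \<in> D" for g h
    using subgroup.subset[OF D(1)] that by auto
  have Dm: "(g \<otimes>\<^bsub>G\<^esub> g', h \<otimes>\<^bsub>H\<^esub> h') \<in> D" if "(g, h) \<in> D" "(g', h') \<in> D" for g h g' h'
    using subgroup.m_closed[OF D(1) that] by simp
  have Di: "(inv\<^bsub>G\<^esub> g, inv\<^bsub>H\<^esub> h) \<in> D" if "(g, h) \<in> D" for g h
    using subgroup.m_inv_closed[OF D(1) that] DC[OF that]
    by (simp add: inv_DirProd G.group_axioms H.group_axioms)
  have D1: "(\<one>\<^bsub>G\<^esub>, \<one>\<^bsub>H\<^esub>) \<in> D" using subgroup.one_closed[OF D(1)] by simp
  \<comment> \<open>\<open>N \<times> {\<one>}\<close> is the kernel of the projection of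
    \<open>D\<close> to \<open>H\<close>; the nonempty fibres of this projection are its
    translates.\<close>
  define N where "N = {g. (g, \<one>\<^bsub>H\<^esub>) \<in> D}"
  have "subgroup N G"
  proof (rule G.subgroupI)
    show "N \<subseteq> carrier G" unfolding N_def using DC by blast
    show "N \<noteq> {}" unfolding N_def using D1 by blast
    show "inv\<^bsub>G\<^esub> a \<in> N" if "a \<in> N" for a
      using Di[of a "\<one>\<^bsub>H\<^esub>"] that unfolding N_def by simp
    show "a \<otimes>\<^bsub>G\<^esub> b \<in> N" if "a \<in> N" "b \<in> N" for a b
      using Dm[of a "\<one>\<^bsub>H\<^esub>" b "\<one>\<^bsub>H\<^esub>"] that unfolding N_def by simp
  qed
  have "continuous_map S (prod_topology S T) (\<lambda>g. (g, \<one>\<^bsub>H\<^esub>))"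
    by (intro continuous_map_pairedI) (auto simp: H.topspace_eq)
  then have "closedin S {g \<in> topspace S. (g, \<one>\<^bsub>H\<^esub>) \<in> D}"
    using D(2) by (rule closedin_continuous_map_preimage)
  moreover have "{g \<in> topspace S. (g, \<one>\<^bsub>H\<^esub>) \<in> D} = N"
    unfolding N_def G.topspace_eq using DC by blast
  ultimately have "closedin S N" by simp
  have N: "separable_space (subtopology S N)"
    using assms(2,3) \<open>subgroup N G\<close> \<open>closedin S N\<close> by (rule G.separable_closed_subgroup)
  define K where "K = snd ` D"
  have "subgroup K H"
  proof (rule H.subgroupI)
    show "K \<subseteq> carrier H" unfolding K_def using DC by auto
    show "K \<noteq> {}" unfolding K_def using D1 by blast
    show "inv\<^bsub>H\<^esub> a \<in> K" if "a \<in> K" for a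
      using that Di unfolding K_def by force
    show "a \<otimes>\<^bsub>H\<^esub> b \<in> K" if "a \<in> K" "b \<in> K" for a b
      using that Dm unfolding K_def by force
  qed
  \<comment> \<open>Projection along a compact factor is a closed map. This gives closedness of
    \<open>K\<close> and, through complements, openness of the projection of
    \<open>D\<close>.\<close>
  have closed_snd: "closedin T (snd ` C)" if "closedin (prod_topology S T) C" for C
    using closed_map_snd[OF assms(2), of T] that unfolding closed_map_def by blast
  have "closedin T K" unfolding K_def using D(2) by (rule closed_snd)
  show "separable_space (subtopology (prod_topology S T) D)"
  proof (rule separable_space_open_map_fibres)
    show "separable_space (subtopology T K)"
      using \<open>subgroup K H\<close> \<open>closedin T K\<close> by (rule assms(5))
    show "open_map (subtopology (prod_topology S T) D) (subtopology T K) snd"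
      unfolding open_map_def
    proof (intro allI impI)
      fix U assume "openin (subtopology (prod_topology S T) D) U"
      then obtain W where W: "openin (prod_topology S T) W" "U = W \<inter> D"
        unfolding openin_subtopology by blast
      \<comment> \<open>\<open>W'\<close> is the saturation of \<open>W\<close> under right
        translation by \<open>N \<times> {\<one>}\<close>, so each fibre of \<open>D\<close> lies
        inside \<open>W'\<close> or misses it. Hence the image of \<open>U\<close> is the complement
        in \<open>K\<close> of the closed image of \<open>D - W'\<close>.\<close>
      define W' where "W' = (\<Union>n\<in>N. {p \<in> carrier (G \<times>\<times> H). p \<otimes>\<^bsub>G \<times>\<times> H\<^esub> (n, \<one>\<^bsub>H\<^esub>) \<in> W})"
      have "openin (prod_topology S T) {p \<in> carrier (G \<times>\<times> H). p \<otimes>\<^bsub>G \<times>\<times> H\<^esub> (n, \<one>\<^bsub>H\<^esub>) \<in> W}"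
        if "n \<in> N" for n
        using W(1) that DC unfolding N_def by (intro P.openin_translate_right) auto
      then have "openin (prod_topology S T) W'" unfolding W'_def by (intro openin_Union) blast
      then have "closedin T (snd ` (D - W'))" using D(2) by (intro closed_snd closedin_diff)
      moreover have "snd ` U = K - snd ` (D - W')"
      proof (intro equalityI subsetI)
        fix h assume "h \<in> snd ` U"
        then obtain g where g: "(g, h) \<in> W" "(g, h) \<in> D" using W(2) by auto
        have "(g', h) \<in> W'" if g': "(g', h) \<in> D" for g'
        proof -
          have c: "g \<in> carrier G" "g' \<in> carrier G" "h \<in> carrier H" using DC g(2) g' by blast+
          have "inv\<^bsub>G\<^esub> g' \<otimes>\<^bsub>G\<^esub> g \<in> N"
            using Dm[OF Di[OF g'] g(2)] c unfolding N_def by simp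
          moreover have "(g', h) \<otimes>\<^bsub>G \<times>\<times> H\<^esub> (inv\<^bsub>G\<^esub> g' \<otimes>\<^bsub>G\<^esub> g, \<one>\<^bsub>H\<^esub>) = (g, h)"
            using c by (simp flip: G.m_assoc)
          ultimately show ?thesis unfolding W'_def using c g(1)
            by (intro UN_I[of "inv\<^bsub>G\<^esub> g' \<otimes>\<^bsub>G\<^esub> g"] CollectI conjI) (auto simp del: mult_DirProd)
        qed
        then show "h \<in> K - snd ` (D - W')" using g(2) unfolding K_def by force
      next
        fix h assume h: "h \<in> K - snd ` (D - W')"
        then obtain g where g: "(g, h) \<in> D" unfolding K_def by auto
        then have "(g, h) \<in> W'" using h by force
        then obtain n where n: "n \<in> N" "(g \<otimes>\<^bsub>G\<^esub> n, h) \<in> W"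
          using DC[OF g] unfolding W'_def by auto
        have "(g \<otimes>\<^bsub>G\<^esub> n, h) \<in> D" using Dm[OF g, of n "\<one>\<^bsub>H\<^esub>"] n(1) DC[OF g] unfolding N_def by simp
        then show "h \<in> snd ` U" using n(2) W(2) by force
      qed
      ultimately have "snd ` U = K \<inter> (topspace T - snd ` (D - W'))"
        "openin T (topspace T - snd ` (D - W'))"
        using closedin_subset[OF \<open>closedin T K\<close>] by auto
      then show "openin (subtopology T K) (snd ` U)" by (simp add: openin_subtopology_Int2)
    qed
  next
    fix h assume "h \<in> topspace (subtopology T K)"
    then obtain g where g: "(g, h) \<in> D" unfolding K_def by auto
    let ?F = "{x \<in> topspace (subtopology (prod_topology S T) D). snd x = h}"
    \<comment> \<open>Left translation by \<open>(g, h)\<close> carries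
      \<open>N \<times> {\<one>}\<close> onto the fibre over \<open>h\<close>, which is thus a
      continuous image of the separable space \<open>N\<close>.\<close>
    have "continuous_map S (prod_topology S T) (\<lambda>n. (g \<otimes>\<^bsub>G\<^esub> n, h))"
      using DC[OF g] by (intro continuous_map_pairedI G.continuous_map_translate_left) (auto simp: H.topspace_eq)
    then have cont: "continuous_map (subtopology S N) (prod_topology S T) (\<lambda>n. (g \<otimes>\<^bsub>G\<^esub> n, h))"
      by (rule continuous_map_from_subtopology)
    have image: "(\<lambda>n. (g \<otimes>\<^bsub>G\<^esub> n, h)) ` N = ?F"
    proof (intro equalityI subsetI)
      fix x assume "x \<in> (\<lambda>n. (g \<otimes>\<^bsub>G\<^esub> n, h)) ` N"
      then obtain n where n: "n \<in> N" "x = (g \<otimes>\<^bsub>G\<^esub> n, h)" by blast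
      then have "x \<in> D" using Dm[OF g, of n "\<one>\<^bsub>H\<^esub>"] DC[OF g] unfolding N_def by simp
      then show "x \<in> ?F" using n(2) closedin_subset[OF D(2)] by auto
    next
      fix x assume "x \<in> ?F"
      then obtain g' where g': "x = (g', h)" "(g', h) \<in> D" by (cases x) auto
      have c: "g \<in> carrier G" "g' \<in> carrier G" "h \<in> carrier H" using DC g g'(2) by blast+
      have "inv\<^bsub>G\<^esub> g \<otimes>\<^bsub>G\<^esub> g' \<in> N" using Dm[OF Di[OF g] g'(2)] c unfolding N_def by simp
      moreover have "g' = g \<otimes>\<^bsub>G\<^esub> (inv\<^bsub>G\<^esub> g \<otimes>\<^bsub>G\<^esub> g')" using c by (simp flip: G.m_assoc)
      ultimately show "x \<in> (\<lambda>n. (g \<otimes>\<^bsub>G\<^esub> n, h)) ` N" unfolding g'(1) by blast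
    qed
    have "topspace (subtopology S N) = N"
      using closedin_subset[OF \<open>closedin S N\<close>] by auto
    moreover have "topspace (subtopology (prod_topology S T) ?F) = ?F" by auto
    moreover have "continuous_map (subtopology S N) (subtopology (prod_topology S T) ?F) (\<lambda>n. (g \<otimes>\<^bsub>G\<^esub> n, h))"
      using cont image calculation(1) by (intro continuous_map_into_subtopology) blast+
    ultimately have "separable_space (subtopology (prod_topology S T) ?F)"
      using image by (intro separable_space_continuous_map_image[OF N]) simp_all
    moreover have "subtopology (subtopology (prod_topology S T) D) ?F = subtopology (prod_topology S T) ?F"
      unfolding subtopology_subtopology by (rule arg_cong[where f = "subtopology _"]) auto
    ultimately show "separable_space (subtopology (subtopology (prod_topology S T) D) ?F)" by simp
  qed
qed

end
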